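(* Let $G$ be a graph and let $t$ be a positive integer. Then $\operatorname{th}_{\lfloor \operatorname{Z}\rfloor}(G) \leq t$ if and only if there exist integers $a \geq 1$ and $b \geq 0$ such that $a+b=t$ and $G$ can be obtained (up to isomorphism) from the Cartesian product $K_a \square P_{b+1}$ by contracting path edges and deleting edges.
   Context: All graphs are finite, simple, undirected, with nonempty vertex set. $K_a$ is the complete graph on $a$ vertices and $P_{b+1}$ is the path on $b+1$ vertices. Path edges: the path edges of $K_a\square P_{b+1}$ are the edges lying in the copies of $P_{b+1}$ in the Cartesian product (the complete edges are those lying in the copies of $K_a$). "Obtained by contracting path edges and deleting edges" means: contract a (possibly empty) set of path edges (parallel edges arising are merged so that the graph stays simple), and delete a (possibly empty) set of edges; no vertices are deleted. $\lfloor \operatorname{Z}\rfloor$ forcing: each vertex of $G$ is blue or white. A vertex is active if it is blue and has not yet performed a force. The $\lfloor \operatorname{Z}\rfloor$ color change rule: (i) a blue vertex $u$ can force a white vertex $w$ to become blue if $w$ is the only white neighbor of $u$; or (ii) if $v$ is active and all neighbors of $v$ are blue, then $v$ can force any single white vertex $w$ of $G$ to become blue (a "hop"). Write $u\to w$ when $u$ forces $w$. For $B\subseteq V(G)$, color $B$ blue and $V(G)\setminus B$ white, and apply the rule repeatedly, one force at a time, until no longer possible; the unordered set $\mathcal F$ of forces performed is called a set of $\lfloor \operatorname{Z}\rfloor$ forces of $B$ (it depends on choices). Put $\mathcal F^{(0)}=B$, and for $t\ge 0$ let $\mathcal F^{(t+1)}$ be the set of (white) vertices $w$ such that some force $v\to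 w$ is in $\mathcal F$ and $v$ can force $w$ by the rule when exactly the vertices in $\bigcup_{i=0}^t\mathcal F^{(i)}$ are blue. The propagation time $\operatorname{pt}_{\lfloor \operatorname{Z}\rfloor}(G;\mathcal F)$ is the least $t'$ with $V(G)=\bigcup_{i=0}^{t'}\mathcal F^{(i)}$, and is $\infty$ if the forces in $\mathcal F$ do not color all of $V(G)$ blue. Define $\operatorname{pt}_{\lfloor \operatorname{Z}\rfloor}(G;B)$ as the minimum of $\operatorname{pt}_{\lfloor \operatorname{Z}\rfloor}(G;\mathcal F)$ over all sets $\mathcal F$ of $\lfloor \operatorname{Z}\rfloor$ forces of $B$, $\operatorname{th}_{\lfloor \operatorname{Z}\rfloor}(G;B)=|B|+\operatorname{pt}_{\lfloor \operatorname{Z}\rfloor}(G;B)$, and $\operatorname{th}_{\lfloor \operatorname{Z}\rfloor}(G)=\min_{B\subseteq V(G)}\operatorname{th}_{\lfloor \operatorname{Z}\rfloor}(G;B)$. *)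

theory Defs
  imports "Graph_Theory.Graph_Theory" "HOL-Library.Extended_Nat"
begin

text \<open>
  A finite simple undirected graph is a \<^locale>\<open>pair_graph\<close>: a loopless symmetric finite digraph
  without parallel arcs.  An undirected edge is thus a pair of opposite arcs, and
  \<open>parcs G `` {v}\<close> is the neighbourhood of \<open>v\<close>.
\<close>

section \<open>Floor-Z forcing\<close>

text \<open>
  \<open>can_force G U P v w\<close>: the color change rule, when \<open>U\<close> is the set of blue vertices and \<open>P\<close> the set
  of vertices that have already performed a force, so that \<open>U - P\<close> is the set of active vertices.
  The second disjunct is the hop.
\<close>

definition can_force :: "'a pair_pre_digraph \<Rightarrow> 'a set \<Rightarrow> 'a set \<Rightarrow> 'a \<Rightarrow> 'a \<Rightarrow> bool" where
  "can_force G U P v w \<longleftrightarrow>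
     w \<in> pverts G - U \<and>
     (v \<in> U \<and> parcs G `` {v} - U = {w} \<or>
      v \<in> U - P \<and> parcs G `` {v} \<subseteq> U)"

text \<open>
  \<open>performed G B F\<close>: \<open>F\<close> is the set of forces performed in finitely many steps from \<open>B\<close>.  A pair
  \<open>(v, w)\<close> stands for the force \<open>v \<rightarrow> w\<close>, so after \<open>F\<close> the blue vertices are \<open>B \<union> Range F\<close>.
\<close>

inductive performed :: "'a pair_pre_digraph \<Rightarrow> 'a set \<Rightarrow> 'a rel \<Rightarrow> bool" for G B where
  start: "performed G B {}"
| force: "performed G B F \<Longrightarrow> can_force G (B \<union> Range F) (Domain F) v w \<Longrightarrow>
    performed G B (insert (v, w) F)"

definition forces_of :: "'a pair_pre_digraph \<Rightarrow> 'a set \<Rightarrow> 'a rel set" where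
  "forces_of G B =
     {F. performed G B F \<and> (\<nexists>v w. can_force G (B \<union> Range F) (Domain F) v w)}"

text \<open>
  The sets \<open>F\<^sup>(\<^sup>t\<^sup>)\<close>.  When exactly the vertices of \<open>U\<close> are blue, the forces of \<open>F\<close> performed so far are
  those with target in \<open>U\<close>, so that the vertices having performed a force are \<open>F\<inverse> `` U\<close>.
\<close>

fun force_layer :: "'a pair_pre_digraph \<Rightarrow> 'a set \<Rightarrow> 'a rel \<Rightarrow> nat \<Rightarrow> 'a set" where
  "force_layer G B F 0 = B"
| "force_layer G B F (Suc t) =
     (let U = (\<Union>i\<in>{..t}. force_layer G B F i)
      in {w. \<exists>v. (v, w) \<in> F \<and> can_force G U (F\<inverse> `` U) v w})"

text \<open>In \<^typ>\<open>enat\<close>, \<open>Inf {} = \<infinity>\<close>, and the infimum of a nonempty set is its least element.\<close>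

definition pt_forces :: "'a pair_pre_digraph \<Rightarrow> 'a set \<Rightarrow> 'a rel \<Rightarrow> enat" where
  "pt_forces G B F = Inf {enat t | t. pverts G = (\<Union>i\<in>{..t}. force_layer G B F i)}"

definition pt_set :: "'a pair_pre_digraph \<Rightarrow> 'a set \<Rightarrow> enat" where
  "pt_set G B = (INF F\<in>forces_of G B. pt_forces G B F)"

definition th_set :: "'a pair_pre_digraph \<Rightarrow> 'a set \<Rightarrow> enat" where
  "th_set G B = enat (card B) + pt_set G B"

definition th :: "'a pair_pre_digraph \<Rightarrow> enat" where
  "th G = (INF B\<in>Pow (pverts G). th_set G B)"


section \<open>Complete graphs, paths, Cartesian products\<close>

definition complete_graph :: "nat \<Rightarrow> nat pair_pre_digraph" where
  "complete_graph n = \<lparr>pverts = {..<n}, parcs = {(i, j). i < n \<and> j < n \<and> i \<noteq> j}\<rparr>"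

text \<open>The index \<open>n\<close> of \<open>path_graph n\<close> is the number of vertices.\<close>

definition path_graph :: "nat \<Rightarrow> nat pair_pre_digraph" where
  "path_graph n =
     \<lparr>pverts = {..<n}, parcs = {(i, j). i < n \<and> j < n \<and> (j = Suc i \<or> i = Suc j)}\<rparr>"

text \<open>Arcs of the Cartesian product lying in the copies of the left, respectively right, factor.\<close>

definition left_arcs :: "'a pair_pre_digraph \<Rightarrow> 'b pair_pre_digraph \<Rightarrow> ('a \<times> 'b) rel" where
  "left_arcs G H = {((u, x), (v, x)) | u v x. (u, v) \<in> parcs G \<and> x \<in> pverts H}"

definition right_arcs :: "'a pair_pre_digraph \<Rightarrow> 'b pair_pre_digraph \<Rightarrow> ('a \<times> 'b) rel" where
  "right_arcs G H = {((u, x), (u, y)) | u x y. u \<in> pverts G \<and> (x, y) \<in> parcs H}"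

definition cart_prod ::
    "'a pair_pre_digraph \<Rightarrow> 'b pair_pre_digraph \<Rightarrow> ('a \<times> 'b) pair_pre_digraph" where
  "cart_prod G H =
     \<lparr>pverts = pverts G \<times> pverts H, parcs = left_arcs G H \<union> right_arcs G H\<rparr>"


section \<open>Contraction and deletion of edges\<close>

text \<open>
  A set of edges is given by a set of arcs in which the orientation is irrelevant.  Contracting \<open>C\<close>
  identifies the vertices of each connected component of the spanning subgraph with edge set \<open>C\<close>;
  loops are dropped and parallel edges merged.
\<close>

definition contract_edges :: "'a pair_pre_digraph \<Rightarrow> 'a rel \<Rightarrow> 'a set pair_pre_digraph" where
  "contract_edges G C =
     (let V = pverts G // (C \<union> C\<inverse>)\<^sup>*
      in \<lparr>pverts = V,
          parcs = {(X, Y). X \<in> V \<and> Y \<in> V \<and> X \<noteq> Y \<and> (\<exists>x\<in>X. \<exists>y\<in>Y. (x, y) \<in> parcs G)}\<rparr>)"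

definition delete_edges :: "'a pair_pre_digraph \<Rightarrow> 'a rel \<Rightarrow> 'a pair_pre_digraph" where
  "delete_edges G D = \<lparr>pverts = pverts G, parcs = parcs G - (D \<union> D\<inverse>)\<rparr>"

definition obtainable_from_product :: "'a pair_pre_digraph \<Rightarrow> nat \<Rightarrow> nat \<Rightarrow> bool" where
  "obtainable_from_product G a b \<longleftrightarrow>
     (\<exists>C D. C \<subseteq> right_arcs (complete_graph a) (path_graph (b + 1)) \<and>
        D \<subseteq> parcs (contract_edges (cart_prod (complete_graph a) (path_graph (b + 1))) C) \<and>
        digraph_iso
          (with_proj G)
          (with_proj (delete_edges
             (contract_edges (cart_prod (complete_graph a) (path_graph (b + 1))) C) D)))"


section \<open>Basic facts\<close>

lemma pair_graph_iff:
  "pair_graph G \<longleftrightarrow>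
     finite (pverts G) \<and> parcs G \<subseteq> pverts G \<times> pverts G \<and> sym (parcs G) \<and> irrefl (parcs G)"
proof
  assume "pair_graph G"
  then interpret pair_graph G .
  show "finite (pverts G) \<and> parcs G \<subseteq> pverts G \<times> pverts G \<and> sym (parcs G) \<and> irrefl (parcs G)"
    using pair_finite_verts in_arcsD1 in_arcsD2 arcs_symmetric pair_no_loops
    by (fastforce simp: sym_def irrefl_def)
next
  assume *: "finite (pverts G) \<and> parcs G \<subseteq> pverts G \<times> pverts G \<and> sym (parcs G) \<and>
    irrefl (parcs G)"
  then have "finite (parcs G)"
    by (meson finite_SigmaI finite_subset)
  with * show "pair_graph G"
    by unfold_locales (auto simp: symmetric_def irrefl_def)
qed

lemma pair_graph_complete_graph: "pair_graph (complete_graph n)"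
  by (auto simp: pair_graph_iff complete_graph_def sym_def irrefl_def)

lemma complete_graph_complete_digraph: "K\<^bsub>n\<^esub> (with_proj (complete_graph n))"
  by (auto simp: complete_digraph_pair_def complete_graph_def)

lemma pair_graph_path_graph: "pair_graph (path_graph n)"
  by (auto simp: pair_graph_iff path_graph_def sym_def irrefl_def)

lemma pair_graph_cart_prod:
  assumes "pair_graph G" "pair_graph H"
  shows "pair_graph (cart_prod G H)"
  using assms
  by (auto simp: pair_graph_iff cart_prod_def left_arcs_def right_arcs_def sym_def irrefl_def)

lemma pair_graph_contract_edges:
  assumes "pair_graph G"
  shows "pair_graph (contract_edges G C)"
proof -
  have "finite (pverts G // r)" for r :: "'a rel"
    using assms by (simp add: pair_graph_iff quotient_def)
  moreover have "sym (parcs G)"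
    using assms by (simp add: pair_graph_iff)
  ultimately show ?thesis
    by (fastforce simp: pair_graph_iff contract_edges_def Let_def sym_def irrefl_def)
qed

lemma pair_graph_delete_edges:
  assumes "pair_graph G"
  shows "pair_graph (delete_edges G D)"
  using assms by (auto simp: pair_graph_iff delete_edges_def sym_def irrefl_def)

end

theory Submission
  imports Defs
begin

text \<open>
  Both sides of the equivalence say that \<open>G\<close> carries a system of \<open>a\<close> tracks over the times
  \<open>0, \<dots>, b\<close>: at each time every track sits at a vertex, each vertex is occupied by a single track,
  during an interval of times, and adjacent vertices are occupied at a common time or are consecutive
  on a track.  Contracting the occupation intervals in the rows of \<open>K\<^sub>a \<box> P\<^sub>b\<^sub>+\<^sub>1\<close> turns tracks into a
  contraction of the product and conversely.  On the forcing side the tracks are the forcing chains: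
  a chain sits at its last blue vertex.  When \<open>u\<close> forces \<open>w\<close>, all neighbours of \<open>u\<close> other than \<open>w\<close>
  are blue, whether the force is a hop or not, and this is the condition on adjacent vertices.
\<close>

section \<open>Tracks\<close>

text \<open>Resting is allowed: \<open>p i c = p i (Suc c)\<close> corresponds to a contracted path
  edge. The condition on arcs is only an implication because edges may be deleted.\<close>

definition tracks :: "'a pair_pre_digraph \<Rightarrow> nat \<Rightarrow> nat \<Rightarrow> (nat \<Rightarrow> nat \<Rightarrow> 'a) \<Rightarrow> bool" where
  "tracks G a b p \<longleftrightarrow>
     pverts G = {p i c | i c. i < a \<and> c \<le> b} \<and>
     (\<forall>i j c d. i < a \<longrightarrow> j < a \<longrightarrow> c \<le> b \<longrightarrow> d \<le> b \<longrightarrow> p i c = p j d \<longrightarrow> i = j) \<and>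
     (\<forall>i c d e. i < a \<longrightarrow> c \<le> d \<longrightarrow> d \<le> e \<longrightarrow> e \<le> b \<longrightarrow> p i c = p i e \<longrightarrow> p i d = p i c) \<and>
     (\<forall>x y. (x, y) \<in> parcs G \<longrightarrow>
        (\<exists>i j c. i < a \<and> j < a \<and> c \<le> b \<and> x = p i c \<and> y = p j c) \<or>
        (\<exists>i c. i < a \<and> c < b \<and> (x = p i c \<and> y = p i (Suc c) \<or> y = p i c \<and> x = p i (Suc c))))"

context
  fixes G :: "'a pair_pre_digraph" and a b :: nat and p :: "nat \<Rightarrow> nat \<Rightarrow> 'a"
  assumes T: "tracks G a b p"
begin

lemma tracks_verts: "pverts G = {p i c | i c. i < a \<and> c \<le> b}"
  using T by (simp add: tracks_def)

lemma tracks_row: "p i c = p j d \<Longrightarrow> i < a \<Longrightarrow> j < a \<Longrightarrow> c \<le> b \<Longrightarrow> d \<le> b \<Longrightarrow> i = j"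
  using T unfolding tracks_def by blast

lemma tracks_convex: "p i c = p i e \<Longrightarrow> i < a \<Longrightarrow> c \<le> d \<Longrightarrow> d \<le> e \<Longrightarrow> e \<le> b \<Longrightarrow> p i d = p i c"
  using T unfolding tracks_def by blast

lemma tracks_arcE:
  assumes "(x, y) \<in> parcs G"
  obtains (column) i j c where "i < a" "j < a" "c \<le> b" "x = p i c" "y = p j c"
    | (forward) i c where "i < a" "c < b" "x = p i c" "y = p i (Suc c)"
    | (backward) i c where "i < a" "c < b" "y = p i c" "x = p i (Suc c)"
proof -
  have "(\<exists>i j c. i < a \<and> j < a \<and> c \<le> b \<and> x = p i c \<and> y = p j c) \<or>
      (\<exists>i c. i < a \<and> c < b \<and> (x = p i c \<and> y = p i (Suc c) \<or> y = p i c \<and> x = p i (Suc c)))"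
    using T assms unfolding tracks_def by simp
  then show thesis using column forward backward by blast
qed

end


section \<open>Tracks and contractions of the product\<close>

text \<open>Arcs are pairs with \<open>fst\<close> and \<open>snd\<close> as ends, so an isomorphism
  must act on them by its vertex map in both components; only the vertex map \<open>h\<close>
  carries information.\<close>

lemma digraph_iso_with_proj_iff:
  assumes "pair_graph G"
  shows "digraph_iso (with_proj G) (with_proj H) \<longleftrightarrow>
    (\<exists>h. inj_on h (pverts G) \<and> pverts H = h ` pverts G \<and> parcs H = map_prod h h ` parcs G)"
proof
  assume "digraph_iso (with_proj G) (with_proj H)"
  then obtain f where f: "pre_digraph.digraph_isomorphism (with_proj G) f"
    and H: "with_proj H = app_iso f (with_proj G)"
    by (auto simp: digraph_iso_def)
  have "pverts H = iso_verts f ` pverts G" "parcs H = iso_arcs f ` parcs G"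
    and ends: "iso_tail f = fst" "iso_head f = snd"
    using arg_cong[OF H, of verts] arg_cong[OF H, of arcs]
      arg_cong[OF H, of tail] arg_cong[OF H, of head] by simp_all
  moreover have "iso_arcs f e = map_prod (iso_verts f) (iso_verts f) e" if "e \<in> parcs G" for e
    using f that by (simp add: pre_digraph.digraph_isomorphism_def ends prod_eq_iff)
  then have "iso_arcs f ` parcs G = map_prod (iso_verts f) (iso_verts f) ` parcs G"
    by (rule image_cong[OF refl])
  ultimately show "\<exists>h. inj_on h (pverts G) \<and> pverts H = h ` pverts G \<and>
      parcs H = map_prod h h ` parcs G"
    using f by (intro exI[of _ "iso_verts f"]) (simp add: pre_digraph.digraph_isomorphism_def)
next
  assume "\<exists>h. inj_on h (pverts G) \<and> pverts H = h ` pverts G \<and> parcs H = map_prod h h ` parcs G"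
  then obtain h where h: "inj_on h (pverts G)" "pverts H = h ` pverts G"
    "parcs H = map_prod h h ` parcs G" by blast
  interpret pair_graph G by fact
  have "parcs G \<subseteq> pverts G \<times> pverts G"
    using assms by (simp add: pair_graph_iff)
  then have "inj_on (map_prod h h) (parcs G)"
    using h(1) by (blast intro: map_prod_inj_on inj_on_subset)
  then show "digraph_iso (with_proj G) (with_proj H)"
    unfolding digraph_iso_def pre_digraph.digraph_isomorphism_def
    by (intro exI[of _ "\<lparr>iso_verts = h, iso_arcs = map_prod h h, iso_head = snd, iso_tail = fst\<rparr>"])
      (use h wf_digraph in \<open>auto simp: app_iso_def with_proj_def\<close>)
qed

section \<open>Connected components of a set of path edges\<close>

lemma equiv_symcl: "equiv UNIV ((C \<union> C\<inverse>)\<^sup>*)"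
  by (intro equivI refl_rtrancl sym_rtrancl sym_Un_converse trans_rtrancl) auto

lemma right_arcs_path_iff:
  "((i, c), (j, d)) \<in> right_arcs (complete_graph a) (path_graph (Suc b)) \<longleftrightarrow>
     i = j \<and> i < a \<and> c \<le> b \<and> d \<le> b \<and> (d = Suc c \<or> c = Suc d)"
  by (auto simp: right_arcs_def complete_graph_def path_graph_def)

lemma left_arcs_path_iff:
  "((i, c), (j, d)) \<in> left_arcs (complete_graph a) (path_graph (Suc b)) \<longleftrightarrow>
     c = d \<and> i < a \<and> j < a \<and> i \<noteq> j \<and> c \<le> b"
  by (auto simp: left_arcs_def complete_graph_def path_graph_def)

lemma verts_product:
  "pverts (cart_prod (complete_graph a) (path_graph (Suc b))) = {..<a} \<times> {..b}"
  by (auto simp: cart_prod_def complete_graph_def path_graph_def)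

text \<open>An arc of \<open>C\<close> stays in its row and changes the time by one, so a walk
  cannot skip a time between those of its ends. Each contracted class is therefore an interval of a
  row.\<close>

lemma rtrancl_path_arcs:
  assumes "C \<subseteq> right_arcs (complete_graph a) (path_graph (b + 1))"
    and "(x, y) \<in> (C \<union> C\<inverse>)\<^sup>*"
  shows "fst x = fst y \<and>
    (\<forall>d. min (snd x) (snd y) \<le> d \<longrightarrow> d \<le> max (snd x) (snd y) \<longrightarrow> (x, (fst x, d)) \<in> (C \<union> C\<inverse>)\<^sup>*)"
  using assms(2)
proof induction
  case base
  then show ?case by auto
next
  case (step y z)
  have yz: "fst y = fst z" "snd z = Suc (snd y) \<or> snd y = Suc (snd z)"
    using step.hyps(2) assms(1) right_arcs_path_iff[of "fst y" "snd y" "fst z" "snd z" a b]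
      right_arcs_path_iff[of "fst z" "snd z" "fst y" "snd y" a b] by auto
  have z: "(x, z) \<in> (C \<union> C\<inverse>)\<^sup>*"
    using step.hyps by (rule rtrancl_into_rtrancl)
  show ?case
  proof (intro conjI allI impI)
    show "fst x = fst z" using step.IH yz by simp
    fix d assume "min (snd x) (snd z) \<le> d" "d \<le> max (snd x) (snd z)"
    then have "min (snd x) (snd y) \<le> d \<and> d \<le> max (snd x) (snd y) \<or> d = snd z"
      using yz(2) by linarith
    moreover have "(fst x, snd z) = z" using \<open>fst x = fst z\<close> by simp
    ultimately show "(x, (fst x, d)) \<in> (C \<union> C\<inverse>)\<^sup>*"
      using step.IH z by metis
  qed
qed

text \<open>Track \<open>i\<close> at time \<open>c\<close> sits at the vertex of \<open>G\<close>
  that the isomorphism sends to the contraction class of \<open>(i, c)\<close>. That classes are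
  intervals of rows gives disjointness and convexity; an arc of \<open>G\<close> comes from a
  product arc between two classes.\<close>

lemma obtainable_imp_tracks:
  assumes G: "pair_graph G" and "obtainable_from_product G a b"
  shows "\<exists>p. tracks G a b p"
proof -
  let ?P = "cart_prod (complete_graph a) (path_graph (b + 1))"
  obtain C D where C: "C \<subseteq> right_arcs (complete_graph a) (path_graph (b + 1))"
    and "digraph_iso (with_proj G) (with_proj (delete_edges (contract_edges ?P C) D))"
    using assms(2) unfolding obtainable_from_product_def by blast
  then obtain h where inj: "inj_on h (pverts G)"
    and verts: "pverts (delete_edges (contract_edges ?P C) D) = h ` pverts G"
    and arcs: "parcs (delete_edges (contract_edges ?P C) D) = map_prod h h ` parcs G"
    unfolding digraph_iso_with_proj_iff[OF G] by blast
  define R where "R = (C \<union> C\<inverse>)\<^sup>*"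
  have R: "equiv UNIV R"
    unfolding R_def by (rule equiv_symcl)
  have cls: "R `` {x} = R `` {y} \<longleftrightarrow> (x, y) \<in> R" for x y
    using R by (simp add: eq_equiv_class_iff)
  have quot: "({..<a} \<times> {..b}) // R = h ` pverts G"
    using verts by (simp add: delete_edges_def contract_edges_def Let_def R_def verts_product)
  define p where "p i c = the_inv_into (pverts G) h (R `` {(i, c)})" for i c
  have h_p: "h (p i c) = R `` {(i, c)}" and p_in: "p i c \<in> pverts G" if "i < a" "c \<le> b" for i c
  proof -
    have "R `` {(i, c)} \<in> h ` pverts G"
      unfolding quot[symmetric] using that by (intro quotientI) auto
    then show "h (p i c) = R `` {(i, c)}" "p i c \<in> pverts G"
      unfolding p_def
      by (rule f_the_inv_into_f[OF inj], rule the_inv_into_into[OF inj _ subset_refl])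
  qed
  have p_eq: "p i c = p j d \<longleftrightarrow> ((i, c), (j, d)) \<in> R" if "i < a" "c \<le> b" "j < a" "d \<le> b" for i c j d
    using that h_p p_in inj by (metis cls inj_on_eq_iff)
  have p_onto: "\<exists>i c. i < a \<and> c \<le> b \<and> v = p i c \<and> (i, c) \<in> X \<and> X = R `` {(i, c)}"
    if "v \<in> pverts G" "h v = X" for v X
  proof -
    have "X \<in> ({..<a} \<times> {..b}) // R" using that quot by blast
    then obtain i c where "i < a" "c \<le> b" "X = R `` {(i, c)}"
      by (auto elim!: quotientE)
    moreover from this have "v = p i c"
      using that h_p p_in inj by (metis inj_onD)
    ultimately show ?thesis by (auto simp: R_def)
  qed
  have "tracks G a b p"
    unfolding tracks_def
  proof (intro conjI allI impI)
    show "pverts G = {p i c | i c. i < a \<and> c \<le> b}"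
      using p_in p_onto by blast
    show "i = j" if "i < a" "j < a" "c \<le> b" "d \<le> b" "p i c = p j d" for i j c d
      using that p_eq rtrancl_path_arcs[OF C] by (fastforce simp: R_def)
    show "p i d = p i c" if "i < a" "c \<le> d" "d \<le> e" "e \<le> b" "p i c = p i e" for i c d e
    proof -
      have "((i, c), (i, e)) \<in> R" using that p_eq by simp
      then have "((i, c), (i, d)) \<in> R"
        using that rtrancl_path_arcs[OF C, of "(i, c)" "(i, e)"] by (simp add: R_def)
      then have "p i c = p i d" using that p_eq by simp
      then show ?thesis by simp
    qed
    fix x y assume xy: "(x, y) \<in> parcs G"
    have "(h x, h y) \<in> parcs (contract_edges ?P C)"
      using xy arcs by (auto simp: delete_edges_def)
    then obtain u v where uv: "u \<in> h x" "v \<in> h y" "(u, v) \<in> parcs ?P"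
      by (auto simp: contract_edges_def Let_def)
    obtain i c j d where ij: "u = (i, c)" "v = (j, d)" by fastforce
    have lr: "(c = d \<and> i < a \<and> j < a \<and> c \<le> b) \<or>
        (i = j \<and> i < a \<and> c \<le> b \<and> d \<le> b \<and> (d = Suc c \<or> c = Suc d))"
      using uv(3) left_arcs_path_iff[of i c j d] right_arcs_path_iff[of i c j d]
      unfolding ij by (auto simp: cart_prod_def)
    have member: "z = p k e" if "z \<in> pverts G" "(k, e) \<in> h z" "k < a" "e \<le> b" for z k e
      using p_onto[OF that(1) refl] that p_eq by blast
    have "x = p i c" "y = p j d"
      using xy G uv lr ij by (auto intro!: member simp: pair_graph_iff)
    with lr consider "c \<le> b" "x = p i c" "y = p j c" "i < a" "j < a"
      | "c < b" "x = p i c" "y = p i (Suc c)" "i < a" | "d < b" "y = p i d" "x = p i (Suc d)" "i < a"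
      using Suc_le_lessD by blast
    then show "(\<exists>i j c. i < a \<and> j < a \<and> c \<le> b \<and> x = p i c \<and> y = p j c) \<or>
        (\<exists>i c. i < a \<and> c < b \<and> (x = p i c \<and> y = p i (Suc c) \<or> y = p i c \<and> x = p i (Suc c)))"
      by cases blast+
  qed
  then show ?thesis by blast
qed

text \<open>The path edges to contract are those along which a track rests. By convexity the classes
  are then the fibres of the position map, one for each vertex of \<open>G\<close>. Every arc of
  \<open>G\<close> comes from the product, so deleting the surplus arcs leaves a copy of
  \<open>G\<close>.\<close>

lemma tracks_imp_obtainable:
  assumes G: "pair_graph G" and T: "tracks G a b p"
  shows "obtainable_from_product G a b"
proof -
  let ?P = "cart_prod (complete_graph a) (path_graph (b + 1))"
  let ?A = "right_arcs (complete_graph a) (path_graph (b + 1))"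
  let ?q = "\<lambda>x. p (fst x) (snd x)"
  define C where "C = {(x, y) \<in> ?A. ?q x = ?q y}"
  define R where "R = (C \<union> C\<inverse>)\<^sup>*"
  define h where "h v = {x \<in> {..<a} \<times> {..b}. ?q x = v}" for v
  define K where "K = contract_edges ?P C"
  define D where "D = parcs K - map_prod h h ` parcs G"
  have R: "equiv UNIV R"
    unfolding R_def by (rule equiv_symcl)
  have C_q: "?q x = ?q y \<and> x \<in> {..<a} \<times> {..b} \<and> y \<in> {..<a} \<times> {..b}" if "(x, y) \<in> C" for x y
    using that by (cases x; cases y) (auto simp: C_def right_arcs_path_iff)
  have R_q: "?q x = ?q y \<and> y \<in> {..<a} \<times> {..b}" if "(x, y) \<in> R" "x \<in> {..<a} \<times> {..b}" for x y
    using that(1) unfolding R_def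
  proof induction
    case (step y z)
    then show ?case using C_q by (metis Un_iff converseD)
  qed (use that in simp)
  \<comment> \<open>Convexity puts every intermediate time at the same vertex, so each unit step
    between the two times is an edge of \<open>C\<close>.\<close>
  have row: "((i, c), (i, c + n)) \<in> R" if "i < a" "c + n \<le> b" "p i c = p i (c + n)" for i c n
    using that
  proof (induction n)
    case 0
    show ?case by (simp add: R_def)
  next
    case (Suc n)
    have eq: "p i (c + n) = p i c"
      by (rule tracks_convex[OF T Suc.prems(3)]) (use Suc.prems in auto)
    with Suc have "((i, c), (i, c + n)) \<in> R" by simp
    moreover have "((i, c + n), (i, c + Suc n)) \<in> C"
      using Suc.prems eq by (simp add: C_def right_arcs_path_iff)
    ultimately show ?case
      unfolding R_def by (auto intro: rtrancl_into_rtrancl)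
  qed
  have R_iff: "(x, y) \<in> R \<longleftrightarrow> y \<in> {..<a} \<times> {..b} \<and> ?q x = ?q y" if x: "x \<in> {..<a} \<times> {..b}" for x y
  proof
    assume r: "y \<in> {..<a} \<times> {..b} \<and> ?q x = ?q y"
    obtain i c j d where [simp]: "x = (i, c)" "y = (j, d)" by fastforce
    have "i = j" by (rule tracks_row[OF T, of i c j d]) (use r x in auto)
    moreover have "((i, c), (i, d)) \<in> R" if "i = j"
    proof (cases "c \<le> d")
      case True
      then show ?thesis using row[of i c "d - c"] r x that by simp
    next
      case False
      then have "((i, d), (i, c)) \<in> R" using row[of i d "c - d"] r x that by simp
      then show ?thesis using R by (meson equivE symD)
    qed
    ultimately show "(x, y) \<in> R" by simp
  qed (use R_q x in blast)
  have cls: "R `` {x} = h (?q x)" if "x \<in> {..<a} \<times> {..b}" for x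
    using R_iff[OF that] by (auto simp: h_def)
  have h_mem: "x \<in> h v \<longleftrightarrow> x \<in> {..<a} \<times> {..b} \<and> ?q x = v" for x v
    by (auto simp: h_def)
  have ex: "\<exists>x. x \<in> h v" if "v \<in> pverts G" for v
    using that tracks_verts[OF T] by (auto simp: h_mem)
  have inj: "inj_on h (pverts G)"
    using ex by (metis h_mem inj_onI)
  have "({..<a} \<times> {..b}) // R = (\<lambda>x. h (?q x)) ` ({..<a} \<times> {..b})"
    using cls by (auto simp: quotient_def)
  also have "\<dots> = h ` pverts G"
    unfolding tracks_verts[OF T] by force
  finally have verts: "pverts K = h ` pverts G"
    by (simp add: K_def contract_edges_def Let_def verts_product R_def)
  have mem_arcs: "(h x, h y) \<in> parcs K"
    if "u \<in> h x" "v \<in> h y" "(u, v) \<in> parcs ?P" "x \<in> pverts G" "y \<in> pverts G" "x \<noteq> y" for x y u v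
  proof -
    have "h x \<noteq> h y" using inj that by (meson inj_onD)
    moreover have "h x \<in> pverts K" "h y \<in> pverts K" using verts that by auto
    ultimately show ?thesis
      using that by (auto simp: K_def contract_edges_def Let_def)
  qed
  have h_arc: "(h x, h y) \<in> parcs K" if xy: "(x, y) \<in> parcs G" for x y
  proof -
    have ne: "x \<noteq> y" and V: "x \<in> pverts G" "y \<in> pverts G"
      using G xy by (auto simp: pair_graph_iff irrefl_def)
    have "\<exists>u v. u \<in> h x \<and> v \<in> h y \<and> (u, v) \<in> parcs ?P"
      using T xy
    proof (cases rule: tracks_arcE)
      case (column i j c)
      then show ?thesis using ne
        by (intro exI[of _ "(i, c)"] exI[of _ "(j, c)"])
          (auto simp: h_mem cart_prod_def left_arcs_path_iff)
    next
      case (forward i c)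
      then show ?thesis
        by (intro exI[of _ "(i, c)"] exI[of _ "(i, Suc c)"])
          (use right_arcs_path_iff[of i c i "Suc c" a b] in \<open>auto simp: h_mem cart_prod_def\<close>)
    next
      case (backward i c)
      then show ?thesis
        by (intro exI[of _ "(i, Suc c)"] exI[of _ "(i, c)"])
          (use right_arcs_path_iff[of i "Suc c" i c a b] in \<open>auto simp: h_mem cart_prod_def\<close>)
    qed
    then show ?thesis
      using mem_arcs ne V by blast
  qed
  then have arcs: "map_prod h h ` parcs G \<subseteq> parcs K" by auto
  have sym_G: "sym (parcs G)" using G by (simp add: pair_graph_iff)
  have "pair_graph K"
    unfolding K_def
    by (intro pair_graph_contract_edges pair_graph_cart_prod pair_graph_complete_graph
        pair_graph_path_graph)
  then have sym_K: "sym (parcs K)" by (simp add: pair_graph_iff)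
  have "sym (map_prod h h ` parcs G)"
    using sym_G by (fastforce simp: sym_def)
  \<comment> \<open>\<open>delete_edges\<close> removes \<open>D\<close> in both orientations;
    symmetry of \<open>D\<close> ensures that no arc coming from \<open>G\<close> is removed with
    it.\<close>
  moreover have "(r - s)\<inverse> = r - s" if "sym r" "sym s" for r s :: "(nat \<times> nat) set rel"
    using that unfolding sym_def by auto
  ultimately have "D\<inverse> = D"
    using sym_K unfolding D_def by blast
  then have "parcs (delete_edges K D) = map_prod h h ` parcs G"
    using arcs by (auto simp: delete_edges_def D_def)
  moreover have "pverts (delete_edges K D) = h ` pverts G"
    using verts by (simp add: delete_edges_def)
  ultimately have "digraph_iso (with_proj G) (with_proj (delete_edges K D))"
    using digraph_iso_with_proj_iff[OF G] inj by blast
  moreover have "C \<subseteq> ?A" "D \<subseteq> parcs K"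
    by (auto simp: C_def D_def)
  ultimately show ?thesis
    unfolding obtainable_from_product_def K_def by blast
qed


section \<open>The throttling number\<close>

definition blue_at :: "'a pair_pre_digraph \<Rightarrow> 'a set \<Rightarrow> 'a rel \<Rightarrow> nat \<Rightarrow> 'a set" where
  "blue_at G B F t = (\<Union>i\<in>{..t}. force_layer G B F i)"

lemma blue_at_iff: "v \<in> blue_at G B F t \<longleftrightarrow> (\<exists>s\<le>t. v \<in> force_layer G B F s)"
  by (auto simp: blue_at_def)

lemma blue_at_0 [simp]: "blue_at G B F 0 = B"
  by (simp add: blue_at_def)

lemma blue_at_Suc: "blue_at G B F (Suc t) = blue_at G B F t \<union> force_layer G B F (Suc t)"
  by (simp only: blue_at_def atMost_Suc UN_insert Un_commute)

lemma blue_at_mono: "s \<le> t \<Longrightarrow> blue_at G B F s \<subseteq> blue_at G B F t"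
  unfolding blue_at_def by (intro UN_mono) auto

lemma force_layer_Suc_iff:
  "w \<in> force_layer G B F (Suc t) \<longleftrightarrow>
     (\<exists>v. (v, w) \<in> F \<and> can_force G (blue_at G B F t) (F\<inverse> `` blue_at G B F t) v w)"
  by (simp add: Let_def blue_at_def)

declare force_layer.simps(2) [simp del]

lemma force_layer_subset: "B \<subseteq> pverts G \<Longrightarrow> force_layer G B F t \<subseteq> pverts G"
  by (cases t) (auto simp: force_layer_Suc_iff can_force_def)

lemma blue_at_subset: "B \<subseteq> pverts G \<Longrightarrow> blue_at G B F t \<subseteq> pverts G"
  unfolding blue_at_def by (intro UN_least force_layer_subset)

text \<open>A nonempty set of \<open>enat\<close> contains its infimum, by well-ordering, and the
  empty set has infimum infinity, which exceeds every finite bound.\<close>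

lemma Inf_enat_le_iff: "Inf A \<le> enat n \<longleftrightarrow> (\<exists>x\<in>A. x \<le> enat n)"
proof
  assume le: "Inf A \<le> enat n"
  then have "A \<noteq> {}" by (auto simp: top_enat_def)
  then have "Inf A \<in> A" by (auto simp: Inf_enat_def intro: LeastI)
  with le show "\<exists>x\<in>A. x \<le> enat n" by blast
qed (meson Inf_lower order_trans)

text \<open>The three nested infima are attained when the bound is finite. The time \<open>s\<close>
  is any time at which all vertices are blue, not necessarily the least one.\<close>

lemma th_le_iff:
  "th G \<le> enat t \<longleftrightarrow>
     (\<exists>B F s. B \<subseteq> pverts G \<and> F \<in> forces_of G B \<and> pverts G = blue_at G B F s \<and> card B + s \<le> t)"
    (is "_ \<longleftrightarrow> ?R")
proof
  assume "th G \<le> enat t"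
  then obtain B where B: "B \<subseteq> pverts G" "th_set G B \<le> enat t"
    by (auto simp: th_def Inf_enat_le_iff)
  then obtain r where r: "pt_set G B = enat r" "card B + r \<le> t"
    by (cases "pt_set G B") (auto simp: th_set_def)
  then have "pt_set G B \<le> enat r" by simp
  then obtain F s where "F \<in> forces_of G B" "pverts G = blue_at G B F s" "s \<le> r"
    by (auto simp: pt_set_def pt_forces_def Inf_enat_le_iff blue_at_def)
  with B r show ?R by (meson add_le_mono order_refl order_trans)
next
  assume ?R
  then obtain B F s where *: "B \<subseteq> pverts G" "F \<in> forces_of G B" "pverts G = blue_at G B F s"
    "card B + s \<le> t" by blast
  have "th G \<le> th_set G B"
    unfolding th_def using *(1) by (intro INF_lower) auto
  also have "\<dots> \<le> enat (card B) + enat s"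
  proof -
    have "pt_set G B \<le> pt_forces G B F"
      unfolding pt_set_def using *(2) by (rule INF_lower)
    also have "\<dots> \<le> enat s"
      unfolding pt_forces_def using *(3) unfolding blue_at_def by (intro Inf_lower) blast
    finally show ?thesis unfolding th_set_def by (rule add_left_mono)
  qed
  also have "\<dots> \<le> enat t" using *(4) by simp
  finally show "th G \<le> enat t" .
qed


section \<open>From forcing chains to tracks\<close>

text \<open>A vertex that has forced has only blue neighbours, so it can no longer force by a unique
  white neighbour, and a hop requires an active vertex. Hence every vertex forces at most once;
  being white when forced, it is also forced at most once. The forces thus form disjoint
  chains.\<close>

lemma performed_chains:
  assumes "performed G B F"
  shows "B \<inter> Range F = {} \<and> single_valued F \<and> single_valued (F\<inverse>) \<and>
    parcs G `` Domain F \<subseteq> B \<union> Range F"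
  using assms
proof induction
  case start
  then show ?case by (auto simp: single_valued_def)
next
  case (force F v w)
  have w: "w \<notin> B \<union> Range F" and N: "parcs G `` {v} \<subseteq> insert w (B \<union> Range F)"
    and v: "parcs G `` {v} - (B \<union> Range F) = {w} \<or> v \<notin> Domain F"
    using force.hyps(2) unfolding can_force_def by blast+
  have "v \<notin> Domain F"
    using v force.IH by blast
  show ?case
  proof (intro conjI)
    show "B \<inter> Range (insert (v, w) F) = {}" "single_valued ((insert (v, w) F)\<inverse>)"
      using w force.IH by (auto simp: single_valued_def)
    show "single_valued (insert (v, w) F)"
      using \<open>v \<notin> Domain F\<close> force.IH by (auto simp: single_valued_def)
    have "parcs G `` Domain (insert (v, w) F) = parcs G `` {v} \<union> parcs G `` Domain F"
      by blast
    also have "\<dots> \<subseteq> insert w (B \<union> Range F)"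
      using force.IH by (intro Un_least N subset_insertI2) simp
    finally show "parcs G `` Domain (insert (v, w) F) \<subseteq> B \<union> Range (insert (v, w) F)"
      by simp
  qed
qed

text \<open>The position at time \<open>t\<close> of the chain starting in \<open>v\<close>: it
  moves on when the forced vertex turns blue and otherwise rests. As a vertex performs at most one
  force, \<open>W\<close> has at most one element and \<open>the_elem\<close> is meaningful.\<close>

fun chain_end :: "'a pair_pre_digraph \<Rightarrow> 'a set \<Rightarrow> 'a rel \<Rightarrow> 'a \<Rightarrow> nat \<Rightarrow> 'a" where
  "chain_end G B F v 0 = v"
| "chain_end G B F v (Suc t) =
     (let u = chain_end G B F v t; W = F `` {u} \<inter> force_layer G B F (Suc t)
      in if W = {} then u else the_elem W)"

locale forcing =
  fixes G :: "'a pair_pre_digraph" and B :: "'a set" and F :: "'a rel"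
  assumes performed: "performed G B F"
begin

abbreviation layer :: "nat \<Rightarrow> 'a set" where "layer \<equiv> force_layer G B F"

abbreviation blue :: "nat \<Rightarrow> 'a set" where "blue \<equiv> blue_at G B F"

abbreviation chain :: "'a \<Rightarrow> nat \<Rightarrow> 'a" where "chain \<equiv> chain_end G B F"

lemma not_forced: "v \<in> B \<Longrightarrow> (u, v) \<notin> F"
  using performed_chains[OF performed] by blast

lemma force_unique: "(v, w) \<in> F \<Longrightarrow> (v, w') \<in> F \<Longrightarrow> w = w'"
  using performed_chains[OF performed] by (meson single_valuedD)

lemma forcer_unique: "(v, w) \<in> F \<Longrightarrow> (v', w) \<in> F \<Longrightarrow> v = v'"
  using performed_chains[OF performed] by (meson converseI single_valuedD)

text \<open>Being forced by only one vertex, \<open>w\<close> entered its layer through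
  \<open>v\<close> itself. Ordinary forces and hops alike require all neighbours of \<open>v\<close>
  other than \<open>w\<close> to be blue.\<close>

lemma layer_SucD:
  assumes "(v, w) \<in> F" "w \<in> layer (Suc t)"
  shows "w \<notin> blue t" "v \<in> blue t" "parcs G `` {v} \<subseteq> insert w (blue t)"
proof -
  have "can_force G (blue t) (F\<inverse> `` blue t) v w"
    using assms forcer_unique force_layer_Suc_iff by metis
  then show "w \<notin> blue t" "v \<in> blue t" "parcs G `` {v} \<subseteq> insert w (blue t)"
    unfolding can_force_def by blast+
qed

lemma forced_layer:
  assumes "(v, w) \<in> F" "w \<in> blue t"
  shows "\<exists>s<t. w \<in> layer (Suc s)"
proof -
  obtain r where "r \<le> t" "w \<in> layer r"
    using assms(2) by (auto simp: blue_at_iff)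
  moreover from this have "r \<noteq> 0" using not_forced[of w v] assms(1) by (cases r) auto
  ultimately show ?thesis by (metis Suc_le_eq not0_implies_Suc)
qed

text \<open>A forced vertex is white just before its layer, so the layer index is the first time at
  which the vertex is blue.\<close>

lemma layer_le:
  assumes "v \<in> layer s" "v \<in> blue t"
  shows "s \<le> t"
proof (rule ccontr)
  assume "\<not> s \<le> t"
  then obtain m where m: "s = Suc m" "t \<le> m" by (cases s) auto
  then obtain u where "(u, v) \<in> F" using assms(1) force_layer_Suc_iff by metis
  then have "v \<notin> blue m" by (rule layer_SucD(1)) (use assms(1) m in simp)
  then show False using assms(2) blue_at_mono[OF m(2), of G B F] by blast
qed

section \<open>Positions of the chains over time\<close>

lemma chain_move:
  assumes "(chain v t, w) \<in> F" "w \<in> layer (Suc t)"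
  shows "chain v (Suc t) = w"
proof -
  have "F `` {chain v t} \<inter> layer (Suc t) = {w}"
    using assms force_unique by blast
  then show ?thesis by (simp add: Let_def)
qed

lemma chain_rest: "F `` {chain v t} \<inter> layer (Suc t) = {} \<Longrightarrow> chain v (Suc t) = chain v t"
  by (simp add: Let_def)

text \<open>The chain sits at its last blue vertex. After a move to \<open>w\<close>, a vertex
  forced by \<open>w\<close> cannot be blue already, because \<open>w\<close> would have been blue
  before it and hence before the move.\<close>

lemma chain_blue:
  assumes "v \<in> B"
  shows "chain v t \<in> blue t \<and> F `` {chain v t} \<inter> blue t = {}"
proof (induction t)
  case 0
  show ?case using assms not_forced by auto
next
  case (Suc t)
  show ?case
  proof (cases "F `` {chain v t} \<inter> layer (Suc t) = {}")
    case True
    then have "chain v (Suc t) = chain v t" by (rule chain_rest)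
    then show ?thesis using Suc True by (auto simp: blue_at_Suc simp del: chain_end.simps)
  next
    case False
    then obtain w where w: "(chain v t, w) \<in> F" "w \<in> layer (Suc t)" by blast
    have "z \<notin> blue (Suc t)" if z: "(w, z) \<in> F" for z
    proof
      assume "z \<in> blue (Suc t)"
      then obtain s where s: "s < Suc t" "z \<in> layer (Suc s)" using forced_layer z by blast
      then have "w \<in> blue s" using layer_SucD(2)[OF z] by simp
      then have "w \<in> blue t" using blue_at_mono[of s t] s by (meson less_Suc_eq_le subsetD)
      then show False using layer_SucD(1)[OF w] by simp
    qed
    moreover have "w \<in> blue (Suc t)" using w(2) by (simp add: blue_at_Suc)
    ultimately show ?thesis
      unfolding chain_move[OF w] by blast
  qed
qed

lemma chain_stay:
  assumes "s \<le> t" "F `` {chain v s} \<inter> blue t = {}"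
  shows "chain v t = chain v s"
  using assms
proof (induction t rule: dec_induct)
  case (step t)
  have "F `` {chain v s} \<inter> (blue t \<union> layer (Suc t)) = {}"
    using step.prems by (simp add: blue_at_Suc)
  then have "chain v t = chain v s" "F `` {chain v s} \<inter> layer (Suc t) = {}"
    using step.IH by blast+
  then show ?case using chain_rest[of v t] by argo
qed simp

text \<open>Going back one step, a resting chain is at a vertex already blue while a moving one
  enters a white vertex. Chains that meet therefore both rested or both moved, and in the latter
  case their sources coincide because a vertex has one forcer.\<close>

lemma chain_inj:
  assumes "u \<in> B" "v \<in> B" "chain u t = chain v t"
  shows "u = v"
  using assms(3)
proof (induction t)
  case (Suc t)
  have step: "chain x (Suc t) = chain x t \<or>
      (chain x t, chain x (Suc t)) \<in> F \<and> chain x (Suc t) \<notin> blue t" for x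
  proof (cases "F `` {chain x t} \<inter> layer (Suc t) = {}")
    case True
    then show ?thesis using chain_rest by blast
  next
    case False
    then obtain w where w: "(chain x t, w) \<in> F" "w \<in> layer (Suc t)" by blast
    then show ?thesis using layer_SucD(1)[OF w] chain_move[OF w] by simp
  qed
  have "chain u t = chain v t"
    using step[of u] step[of v] Suc.prems assms(1,2) chain_blue forcer_unique by metis
  then show ?case by (rule Suc.IH)
qed simp

text \<open>By induction a chain is at the forcer \<open>u\<close> of \<open>w\<close> when
  \<open>u\<close> turns blue. It waits there, as \<open>w\<close>, the only vertex that
  \<open>u\<close> forces, is still white, and moves to \<open>w\<close> on time.\<close>

lemma layer_chain: "w \<in> layer t \<Longrightarrow> \<exists>v\<in>B. w = chain v t"
proof (induction t arbitrary: w rule: less_induct)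
  case (less t)
  show ?case
  proof (cases t)
    case 0
    then show ?thesis using less.prems by auto
  next
    case (Suc s)
    then obtain u where u: "(u, w) \<in> F" using less.prems force_layer_Suc_iff by metis
    then have "w \<notin> blue s" "u \<in> blue s"
      using layer_SucD(1,2)[OF u] less.prems Suc by simp_all
    then obtain r where r: "r \<le> s" "u \<in> layer r" by (auto simp: blue_at_iff)
    then obtain v where v: "v \<in> B" "u = chain v r" using less.IH[of r] Suc by auto
    have "F `` {u} \<inter> blue s = {}" using u \<open>w \<notin> blue s\<close> force_unique by blast
    then have "chain v s = u" using chain_stay r v by simp
    then have "chain v (Suc s) = w" using u less.prems Suc by (intro chain_move) auto
    with v Suc show ?thesis by blast
  qed
qed

text \<open>The end \<open>x\<close>, blue no later than \<open>y\<close>, decides. If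
  \<open>x\<close> has not forced by time \<open>t\<close>, its chain is still at \<open>x\<close>
  when \<open>y\<close> turns blue. Otherwise \<open>x\<close> has forced some \<open>w\<close>
  while all its other neighbours were blue, so the late neighbour \<open>y\<close> is
  \<open>w\<close> itself.\<close>

lemma chain_arc:
  assumes xy: "(x, y) \<in> parcs G" and s: "x \<in> layer s" "y \<in> layer t" "s \<le> t"
  shows "(\<exists>u\<in>B. \<exists>v\<in>B. x = chain u t \<and> y = chain v t) \<or>
    (\<exists>v\<in>B. \<exists>r<t. x = chain v r \<and> y = chain v (Suc r))"
proof -
  obtain u v where uv: "u \<in> B" "v \<in> B" "x = chain u s" "y = chain v t"
    using layer_chain s by metis
  show ?thesis
  proof (cases "F `` {x} \<inter> blue t = {}")
    case True
    then have "x = chain u t" using uv s chain_stay by simp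
    with uv show ?thesis by blast
  next
    case False
    then obtain w r where w: "(x, w) \<in> F" "r < t" "w \<in> layer (Suc r)"
      using forced_layer by blast
    have "y \<notin> blue r" using layer_le[OF s(2)] w(2) leD by blast
    then have "y = w" using layer_SucD(3)[OF w(1,3)] xy by blast
    have "x \<in> blue r" "w \<notin> blue r" using layer_SucD[OF w(1,3)] by auto
    then have "s \<le> r" "F `` {x} \<inter> blue r = {}"
      using layer_le s(1) w(1) force_unique by blast+
    then have "x = chain u r" using uv(3) chain_stay by simp
    moreover from this have "y = chain u (Suc r)"
      using chain_move w \<open>y = w\<close> by simp
    ultimately show ?thesis using uv(1) w(2) by blast
  qed
qed

lemma ex_tracks:
  assumes G: "pair_graph G" and B: "B \<subseteq> pverts G" and all: "pverts G = blue b"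
  shows "\<exists>p. tracks G (card B) b p"
proof -
  have "finite B" using G B finite_subset by (auto simp: pair_graph_iff)
  then obtain e where e: "bij_betw e {..<card B} B"
    using ex_bij_betw_nat_finite atLeast0LessThan by metis
  then have eB: "e i \<in> B" if "i < card B" for i
    using that by (auto simp: bij_betw_def)
  have ex_e: "\<exists>i<card B. e i = v" if "v \<in> B" for v
  proof -
    have "v \<in> e ` {..<card B}" using e that by (simp add: bij_betw_def)
    then show ?thesis by auto
  qed
  have e_inj: "i = j" if "e i = e j" "i < card B" "j < card B" for i j
    using e that by (auto simp: bij_betw_def inj_on_def)
  define p where "p i = chain (e i)" for i
  have p_blue: "p i c \<in> blue c" "F `` {p i c} \<inter> blue c = {}" if "i < card B" for i c
    using that chain_blue eB by (auto simp: p_def)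
  have stay: "p i d = p i c" if "c \<le> d" "F `` {p i c} \<inter> blue d = {}" for i c d
    using that chain_stay by (simp add: p_def)
  have ex_p: "\<exists>i<card B. w = p i c" if "w \<in> layer c" for w c
    using layer_chain[OF that] ex_e by (metis p_def)
  \<comment> \<open>What the shared vertex forces is still white at time \<open>d\<close>, so chain
    \<open>i\<close> has stayed there from \<open>c\<close> to \<open>d\<close>, and chains are
    injective at the common time \<open>d\<close>.\<close>
  have row: "i = j" if "i < card B" "j < card B" "c \<le> d" "p i c = p j d" for i j c d
    using that stay[of c d i] p_blue[of j d] chain_inj[of "e i" "e j" d] eB e_inj by (simp add: p_def)
  have arc: "(\<exists>i j c. i < card B \<and> j < card B \<and> c \<le> b \<and> x = p i c \<and> y = p j c) \<or>
      (\<exists>i c. i < card B \<and> c < b \<and> x = p i c \<and> y = p i (Suc c))"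
    if "(x, y) \<in> parcs G" "x \<in> layer s" "y \<in> layer t" "s \<le> t" "t \<le> b" for x y s t
    using chain_arc[OF that(1-4)]
  proof (elim disjE bexE exE conjE)
    fix u v assume "u \<in> B" "v \<in> B" and xy: "x = chain u t" "y = chain v t"
    then obtain i j where "i < card B" "e i = u" "j < card B" "e j = v" using ex_e by metis
    then show ?thesis using xy that(5) by (auto simp: p_def)
  next
    fix v r assume "v \<in> B" and r: "r < t" and xy: "x = chain v r" "y = chain v (Suc r)"
    then obtain i where "i < card B" "e i = v" using ex_e by metis
    then show ?thesis using xy r that(5) by (metis p_def less_le_trans)
  qed
  have "tracks G (card B) b p"
    unfolding tracks_def
  proof (intro conjI allI impI)
    have "p i c \<in> pverts G" if "i < card B" "c \<le> b" for i c
      using subsetD[OF blue_at_mono[OF that(2)] p_blue(1)[OF that(1)]] all by simp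
    moreover have "\<exists>i c. i < card B \<and> c \<le> b \<and> x = p i c" if "x \<in> pverts G" for x
      using that all ex_p by (metis blue_at_iff)
    ultimately show "pverts G = {p i c | i c. i < card B \<and> c \<le> b}" by blast
    show "i = j" if "i < card B" "j < card B" "c \<le> b" "d \<le> b" "p i c = p j d" for i j c d
      using that row[of i j c d] row[of j i d c] by (metis nat_le_linear)
    \<comment> \<open>What \<open>p i e\<close> forces is white at time \<open>e\<close>, hence at
      time \<open>d\<close> as well, so the chain rests from \<open>c\<close> to
      \<open>d\<close>.\<close>
    show "p i d = p i c" if "i < card B" "c \<le> d" "d \<le> e" "e \<le> b" "p i c = p i e" for i c d e
      using that p_blue[of i e] blue_at_mono[OF that(3), of G B F] by (intro stay) auto
    fix x y assume xy: "(x, y) \<in> parcs G"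
    then have yx: "(y, x) \<in> parcs G" and "x \<in> blue b" "y \<in> blue b"
      using G all by (auto simp: pair_graph_iff sym_def)
    then obtain s t where st: "s \<le> b" "t \<le> b" "x \<in> layer s" "y \<in> layer t"
      by (auto simp: blue_at_iff)
    consider "s \<le> t" | "t \<le> s" by linarith
    then show "(\<exists>i j c. i < card B \<and> j < card B \<and> c \<le> b \<and> x = p i c \<and> y = p j c) \<or>
        (\<exists>i c. i < card B \<and> c < b \<and> (x = p i c \<and> y = p i (Suc c) \<or> y = p i c \<and> x = p i (Suc c)))"
    proof cases
      case 1
      show ?thesis using arc[OF xy st(3,4) 1 st(2)] by blast
    next
      case 2
      show ?thesis using arc[OF yx st(4,3) 2 st(1)] by blast
    qed
  qed
  then show ?thesis by blast
qed

end


section \<open>From tracks to forcing chains\<close>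

text \<open>All neighbours of \<open>p i c\<close> other than \<open>p i (Suc c)\<close> are
  positions at times up to \<open>c\<close>, hence blue. If \<open>p i (Suc c)\<close> is itself a
  neighbour the force is ordinary; otherwise it is a hop, for which \<open>p i c\<close> has to be
  active.\<close>

lemma tracks_can_force:
  assumes T: "tracks G a b p" and ic: "i < a" "c < b"
    and U: "\<And>j d. j < a \<Longrightarrow> d \<le> c \<Longrightarrow> p j d \<in> U"
    and w: "p i (Suc c) \<notin> U" and u: "p i c \<notin> P"
  shows "can_force G U P (p i c) (p i (Suc c))"
proof -
  have ne: "p i c \<noteq> p i (Suc c)" using U[of i c] w ic by auto
  \<comment> \<open>The track leaves this vertex right after time \<open>c\<close>, so by convexity
    it is there at no later time.\<close>
  have same: "j = i \<and> d \<le> c" if "p i c = p j d" "j < a" "d \<le> b" for j d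
  proof -
    have "j = i" using tracks_row[OF T that(1)] ic that by simp
    moreover have "d \<le> c"
      using tracks_convex[OF T, of i c d "Suc c"] that ic ne \<open>j = i\<close>
      by (metis Suc_leI le_SucI not_less order_refl)
    ultimately show ?thesis by simp
  qed
  have "y \<in> insert (p i (Suc c)) U" if "(p i c, y) \<in> parcs G" for y
    using T that
  proof (cases rule: tracks_arcE)
    case (column j k d)
    then show ?thesis using same U by auto
  next
    case (forward j d)
    then have "j = i" "d \<le> c" using same[of j d] by auto
    then show ?thesis using forward U[of i "Suc d"] ic by (cases "d = c") auto
  next
    case (backward j d)
    then have "j = i" "Suc d \<le> c" using same[of j "Suc d"] by auto
    then show ?thesis using backward U[of i d] ic by auto
  qed
  then have "parcs G `` {p i c} \<subseteq> insert (p i (Suc c)) U" by blast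
  moreover have "p i c \<in> U" using U ic by simp
  moreover have "p i (Suc c) \<in> pverts G"
    using tracks_verts[OF T] ic Suc_leI by blast
  ultimately show ?thesis
    unfolding can_force_def using w u by blast
qed

text \<open>The positions at time 0 form \<open>B\<close> and the moves of the tracks are the
  forces. Positions at time \<open>c\<close> are blue after \<open>c\<close> rounds, possibly
  sooner, so \<open>b\<close> rounds suffice.\<close>

lemma tracks_imp_th_le:
  assumes G: "pair_graph G" and T: "tracks G a b p"
  shows "th G \<le> enat (a + b)"
proof -
  define B where "B = (\<lambda>i. p i 0) ` {..<a}"
  define F where "F = {(p i c, p i (Suc c)) | i c. i < a \<and> c < b \<and> p i c \<noteq> p i (Suc c)}"
  \<comment> \<open>A track never returns to a vertex it has left, so a move is determined by its
    source as well as by its target.\<close>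
  have moved: "c = d" if "i < a" "c < b" "d < b" "p i c \<noteq> p i (Suc c)" "p i d \<noteq> p i (Suc d)"
    "p i c = p i d \<or> p i (Suc c) = p i (Suc d)" for i c d
  proof -
    have "\<not> c < d" if "c < b" "d < b" "p i c \<noteq> p i (Suc c)" "p i d \<noteq> p i (Suc d)"
      "p i c = p i d \<or> p i (Suc c) = p i (Suc d)" for c d
    proof
      assume "c < d"
      then have "p i c = p i d \<Longrightarrow> p i (Suc c) = p i c"
        using tracks_convex[OF T, of i c d "Suc c"] that \<open>i < a\<close> by simp
      moreover have "p i (Suc c) = p i (Suc d) \<Longrightarrow> p i d = p i (Suc c)"
        using tracks_convex[OF T, of i "Suc c" "Suc d" d] that \<open>i < a\<close> \<open>c < d\<close> by simp
      ultimately show False using that by metis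
    qed
    from this[of c d] this[of d c] that show ?thesis by (metis linorder_neqE_nat)
  qed
  have target: "w = p i (Suc c)"
    if "(p i c, w) \<in> F" "i < a" "c < b" "p i c \<noteq> p i (Suc c)" for w i c
  proof -
    from that(1) obtain j d where j: "p i c = p j d" "w = p j (Suc d)" "j < a" "d < b"
      "p j d \<noteq> p j (Suc d)"
      unfolding F_def by blast
    then have "i = j" using tracks_row[OF T j(1)] that by simp
    then show ?thesis using moved[of i c d] j that by metis
  qed
  have source: "v = p i c"
    if "(v, p i (Suc c)) \<in> F" "i < a" "c < b" "p i c \<noteq> p i (Suc c)" for v i c
  proof -
    from that(1) obtain j d where j: "p i (Suc c) = p j (Suc d)" "v = p j d" "j < a" "d < b"
      "p j d \<noteq> p j (Suc d)"
      unfolding F_def by blast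
    then have "i = j" using tracks_row[OF T j(1)] that by simp
    then show ?thesis using moved[of i c d] j that by metis
  qed
  have not_B: "p i (Suc c) \<notin> B" if "i < a" "c < b" "p i c \<noteq> p i (Suc c)" for i c
  proof
    assume "p i (Suc c) \<in> B"
    then obtain j where j: "p j 0 = p i (Suc c)" "j < a" by (auto simp: B_def)
    then have "j = i" using tracks_row[OF T j(1)] that by simp
    then have "p i c = p i 0" using tracks_convex[OF T, of i 0 "Suc c" c] j that by simp
    then show False using j that \<open>j = i\<close> by simp
  qed
  have verts: "p i c \<in> pverts G" if "i < a" "c \<le> b" for i c
    using that tracks_verts[OF T] by blast
  have B_sub: "B \<subseteq> pverts G" using verts by (auto simp: B_def)
  have cover: "p j d \<in> U"
    if "B \<subseteq> U" "j < a" "d \<le> b"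
      "\<And>e. e < d \<Longrightarrow> p j e \<in> U \<Longrightarrow> p j e \<noteq> p j (Suc e) \<Longrightarrow> p j (Suc e) \<in> U" for U j d
    using that
  proof (induction d)
    case 0
    then show ?case by (auto simp: B_def)
  next
    case (Suc d)
    have "p j d \<in> U" by (rule Suc.IH) (use Suc.prems in auto)
    then show ?case using Suc.prems(4)[of d] by (metis lessI)
  qed
  have "F \<subseteq> pverts G \<times> pverts G"
    using verts by (fastforce simp: F_def)
  then have "finite F"
    using G by (meson finite_SigmaI finite_subset pair_graph_iff)
  \<comment> \<open>Instead of listing the forces in a valid order, a maximal performable subset of
    \<open>F\<close> is taken. It is all of \<open>F\<close>: a missing move with all earlier moves
    present could still be performed.\<close>
  let ?A = "{E. E \<subseteq> F \<and> performed G B E}"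
  have fin: "finite ?A" using \<open>finite F\<close> by simp
  have ne: "?A \<noteq> {}" using performed.start by blast
  from finite_has_maximal[OF fin ne] obtain E where "E \<in> ?A"
    and "\<forall>E'\<in>?A. E \<subseteq> E' \<longrightarrow> E = E'" by (rule bexE)
  then have E: "E \<subseteq> F" "performed G B E"
    and max: "\<And>E'. E' \<subseteq> F \<Longrightarrow> performed G B E' \<Longrightarrow> E \<subseteq> E' \<Longrightarrow> E = E'"
    by simp_all
  have in_E: "(p i c, p i (Suc c)) \<in> E" if "i < a" "c < b" "p i c \<noteq> p i (Suc c)" for i c
    using that
  proof (induction c arbitrary: i rule: less_induct)
    case (less c)
    show ?case
    proof (rule ccontr)
      assume notin: "(p i c, p i (Suc c)) \<notin> E"
      have "can_force G (B \<union> Range E) (Domain E) (p i c) (p i (Suc c))"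
      proof (rule tracks_can_force[OF T less.prems(1,2)])
        show "p j d \<in> B \<union> Range E" if "j < a" "d \<le> c" for j d
        proof (rule cover)
          fix e assume "e < d" "p j e \<noteq> p j (Suc e)"
          then show "p j (Suc e) \<in> B \<union> Range E"
            using less.IH[of e j] less.prems that by auto
        qed (use that less.prems in auto)
        show "p i (Suc c) \<notin> B \<union> Range E"
          using not_B[OF less.prems] source[OF _ less.prems] notin E(1) by auto
        show "p i c \<notin> Domain E"
          using target[OF _ less.prems] notin E(1) by auto
      qed
      then have "performed G B (insert (p i c, p i (Suc c)) E)"
        using E(2) by (rule performed.force[rotated])
      moreover have "insert (p i c, p i (Suc c)) E \<subseteq> F"
        using E(1) less.prems by (auto simp: F_def)
      ultimately show False using max notin by blast
    qed
  qed
  then have "E = F" using E(1) by (auto simp: F_def)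
  with E have perf: "performed G B F" by simp
  have "p j d \<in> B \<union> Range F" if "j < a" "d \<le> b" for j d
  proof (rule cover)
    fix e assume "e < d" "p j e \<noteq> p j (Suc e)"
    then show "p j (Suc e) \<in> B \<union> Range F"
      using in_E[of j e] that \<open>E = F\<close> by auto
  qed (use that in auto)
  then have "pverts G \<subseteq> B \<union> Range F" using tracks_verts[OF T] by auto
  then have forces: "F \<in> forces_of G B"
    using perf by (auto simp: forces_of_def can_force_def)
  have reach: "\<forall>i<a. \<forall>d\<le>c. p i d \<in> blue_at G B F c" if "c \<le> b" for c
    using that
  proof (induction c)
    case 0
    show ?case by (auto simp: B_def)
  next
    case (Suc c)
    \<comment> \<open>The vertex can be blue already, because the track rests or because its force
      was possible ahead of schedule; otherwise it is forced in this very round.\<close>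
    have "p i (Suc c) \<in> blue_at G B F (Suc c)" if i: "i < a" for i
    proof (cases "p i (Suc c) \<in> blue_at G B F c")
      case False
      have c: "c < b" using Suc.prems by simp
      have ne: "p i c \<noteq> p i (Suc c)" using False Suc i by (metis Suc_leD order_refl)
      have "can_force G (blue_at G B F c) (F\<inverse> `` blue_at G B F c) (p i c) (p i (Suc c))"
      proof (rule tracks_can_force[OF T i c])
        show "p i c \<notin> F\<inverse> `` blue_at G B F c"
          using target[OF _ i c ne] False by blast
        show "p j d \<in> blue_at G B F c" if "j < a" "d \<le> c" for j d
          using Suc.IH c that by simp
      qed (rule False)
      moreover have "(p i c, p i (Suc c)) \<in> F" using i c ne by (auto simp: F_def)
      ultimately have "p i (Suc c) \<in> force_layer G B F (Suc c)"
        using force_layer_Suc_iff by metis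
      then show ?thesis unfolding blue_at_Suc by blast
    qed (simp add: blue_at_Suc)
    moreover have "\<forall>i<a. \<forall>d\<le>c. p i d \<in> blue_at G B F (Suc c)"
      using Suc unfolding blue_at_Suc by simp
    ultimately show ?case by (simp add: le_Suc_eq)
  qed
  have "pverts G = blue_at G B F b"
  proof
    show "pverts G \<subseteq> blue_at G B F b"
      using reach[of b] unfolding tracks_verts[OF T] by blast
    show "blue_at G B F b \<subseteq> pverts G"
      using B_sub by (rule blue_at_subset)
  qed
  moreover have "card B \<le> a"
    unfolding B_def using card_image_le[of "{..<a}"] by simp
  ultimately show ?thesis
    using th_le_iff forces B_sub by (metis add_le_mono1)
qed

theorem theorem3p16:
  fixes G :: "'a pair_pre_digraph" and t :: nat
  assumes "pair_graph G" and "pverts G \<noteq> {}" and "t > 0"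
  shows "th G \<le> enat t \<longleftrightarrow>
    (\<exists>a b. a \<ge> 1 \<and> b \<ge> 0 \<and> a + b = t \<and> obtainable_from_product G a b)"
proof
  assume "th G \<le> enat t"
  then obtain B F s where B: "B \<subseteq> pverts G" and F: "F \<in> forces_of G B"
    and s: "pverts G = blue_at G B F s" "card B + s \<le> t"
    using th_le_iff by metis
  interpret forcing G B F
    using F by unfold_locales (simp add: forces_of_def)
  \<comment> \<open>The number of rounds is taken to be \<open>t - card B\<close>, which may exceed
    \<open>s\<close>; surplus rounds change nothing, and the two parameters then add up to exactly
    \<open>t\<close>.\<close>
  have "blue (t - card B) \<subseteq> pverts G"
    using B by (rule blue_at_subset)
  moreover have "pverts G \<subseteq> blue (t - card B)"
    using s blue_at_mono[of s "t - card B" G B F] by simp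
  ultimately obtain p where p: "tracks G (card B) (t - card B) p"
    using ex_tracks[OF assms(1) B] by blast
  \<comment> \<open>Without tracks there would be no vertices.\<close>
  then have "card B \<ge> 1"
    using tracks_verts[OF p] assms(2) by (cases "card B") auto
  then show "\<exists>a b. a \<ge> 1 \<and> b \<ge> 0 \<and> a + b = t \<and> obtainable_from_product G a b"
    using tracks_imp_obtainable[OF assms(1) p] s(2)
    by (intro exI[of _ "card B"] exI[of _ "t - card B"]) auto
next
  assume "\<exists>a b. a \<ge> 1 \<and> b \<ge> 0 \<and> a + b = t \<and> obtainable_from_product G a b"
  then show "th G \<le> enat t"
    using obtainable_imp_tracks[OF assms(1)] tracks_imp_th_le[OF assms(1)] by blast
qed

end
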